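(* Let $\mathbf{a}=(a_1,a_2,\dots)\in \ell_2$ be a sequence of positive reals such that for every $i$ the number $\frac{1}{a_i}$ is an odd integer strictly greater than one, and suppose that $$\lim_{n\to\infty}\frac{a_1\cdots a_{n-1}}{a_n}=0.$$ Let $S=S_{\mathbf{a}}\subset[0,1]^2$ be the generalized Sierpinski carpet associated with $\mathbf{a}$. Let $\operatorname{curl}:\operatorname{Dom}(\operatorname{curl})\to L^2(S)$ be the curl operator on $S$, with domain $\operatorname{Dom}(\operatorname{curl})\subset L^2(S,\mathbb{R}^2)$. If $\operatorname{Dom}(\operatorname{curl})$ contains all smooth vector fields, then the operator $\operatorname{curl}$ is not closable.
   Context: Generalized Sierpinski carpet. Let $\mathbf{a}=(a_1,a_2,\dots)$ be a sequence of positive reals such that each $\frac1{a_i}$ is an odd integer strictly greater than one. Put $S_{\mathbf{a},0}=[0,1]^2$ and $\mathcal{T}_0=\{[0,1]^2\}$. Given the family $\mathcal{T}_{m-1}$ of closed squares of side length $a_1\cdots a_{m-1}$ (side length $1$ if $m=1$), subdivide each of its elements into $(1/a_m)^2$ congruent closed subsquares of side length $a_1\cdots a_m$ that touch only at their boundaries, and discard the central subsquare of each; $\mathcal{T}_m$ is the family of all remaining subsquares, and $S_{\mathbf{a},m}=\bigcup_{T\in\mathcal{T}_m}T$. The generalized Sierpinski carpet associated with $\mathbf{a}$ is $S_{\mathbf{a}}=\bigcap_{m\ge 0}S_{\mathbf{a},m}$. If $\mathbf{a}\in\ell_2$, every nonempty relatively open subset of $S_{\mathbf{a}}$ has positive two-dimensional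 Lebesgue measure. Function spaces. $L^2(S)=L^2(S,\mathbb{R})$ and $L^2(S,\mathbb{R}^2)$ are the Hilbert spaces of (classes of) real-valued, respectively $\mathbb{R}^2$-valued, functions on $S$ that are square integrable with respect to two-dimensional Lebesgue measure restricted to $S$. Curl. For a smooth vector field $u=(u_1,u_2):\mathbb{R}^2\to\mathbb{R}^2$ one sets $\operatorname{curl}u=\frac{\partial u_2}{\partial x}-\frac{\partial u_1}{\partial y}$. Smooth vector fields are regarded as elements of $L^2(S,\mathbb{R}^2)$ by restriction to $S$, and $\operatorname{curl}u$ as an element of $L^2(S)$ by pointwise restriction to $S$. The curl operator on $S$ is a densely defined unbounded linear operator from $L^2(S,\mathbb{R}^2)$ to $L^2(S)$ with domain $\operatorname{Dom}(\operatorname{curl})$, acting on (restrictions of) smooth vector fields in this way. An operator is closable if the closure of its graph is the graph of an operator. *)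

theory Defs
  imports "HOL-Analysis.Analysis"
begin

section \<open>Generalized Sierpinski carpets\<close>

text \<open>
  The sequence \<open>a\<close> is indexed from 1; the value \<open>a 0\<close> is never used.  A square of
  generation \<open>m\<close> is represented by its lower left corner, its side length being
  \<open>carpet_side a m\<close>.  In the subdivision of a square, the subsquare with indices \<open>(i, j)\<close> is
  the central one iff \<open>2 * i + 1 = 1 / a m = 2 * j + 1\<close>.
\<close>

definition carpet_side :: "(nat \<Rightarrow> real) \<Rightarrow> nat \<Rightarrow> real" where
  "carpet_side a m = (\<Prod>k = 1..m. a k)"

fun carpet_corners :: "(nat \<Rightarrow> real) \<Rightarrow> nat \<Rightarrow> (real \<times> real) set" where
  "carpet_corners a 0 = {(0, 0)}"
| "carpet_corners a (Suc m) =
    {(x + real i * carpet_side a (Suc m), y + real j * carpet_side a (Suc m)) | x y i j.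
       (x, y) \<in> carpet_corners a m \<and>
       real i < 1 / a (Suc m) \<and> real j < 1 / a (Suc m) \<and>
       \<not> (2 * real i + 1 = 1 / a (Suc m) \<and> 2 * real j + 1 = 1 / a (Suc m))}"

definition carpet_squares :: "(nat \<Rightarrow> real) \<Rightarrow> nat \<Rightarrow> (real \<times> real) set set" where
  "carpet_squares a m =
    (\<lambda>(x, y). {x .. x + carpet_side a m} \<times> {y .. y + carpet_side a m}) ` carpet_corners a m"

definition carpet_stage :: "(nat \<Rightarrow> real) \<Rightarrow> nat \<Rightarrow> (real \<times> real) set" where
  "carpet_stage a m = \<Union> (carpet_squares a m)"

definition sierpinski_carpet :: "(nat \<Rightarrow> real) \<Rightarrow> (real \<times> real) set" where
  "sierpinski_carpet a = (\<Inter>m. carpet_stage a m)"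


section \<open>The Hilbert spaces of square integrable functions\<close>

definition L2_fun :: "'p measure \<Rightarrow> ('p \<Rightarrow> 'v::euclidean_space) set" where
  "L2_fun M = {f \<in> borel_measurable M. integrable M (\<lambda>x. (norm (f x))\<^sup>2)}"

text \<open>
  Elements of the Hilbert space are classes modulo equality almost everywhere.  As functions
  are total, a class for \<open>lebesgue_on S\<close> contains all possible extensions of its members beyond
  \<open>S\<close>; thus \<open>L2_class (lebesgue_on S) f\<close> is the class of the restriction of \<open>f\<close> to \<open>S\<close>.
\<close>

definition L2_class :: "'p measure \<Rightarrow> ('p \<Rightarrow> 'v::euclidean_space) \<Rightarrow> ('p \<Rightarrow> 'v) set" where
  "L2_class M f = {g \<in> L2_fun M. AE x in M. g x = f x}"

definition L2 :: "'p measure \<Rightarrow> ('p \<Rightarrow> 'v::euclidean_space) set set" where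
  "L2 M = L2_class M ` L2_fun M"

definition L2_rep :: "('p \<Rightarrow> 'v) set \<Rightarrow> 'p \<Rightarrow> 'v" where
  "L2_rep A = (SOME f. f \<in> A)"

definition L2_zero :: "'p measure \<Rightarrow> ('p \<Rightarrow> 'v::euclidean_space) set" where
  "L2_zero M = L2_class M (\<lambda>x. 0)"

definition L2_add ::
  "'p measure \<Rightarrow> ('p \<Rightarrow> 'v::euclidean_space) set \<Rightarrow> ('p \<Rightarrow> 'v) set \<Rightarrow> ('p \<Rightarrow> 'v) set" where
  "L2_add M A B = L2_class M (\<lambda>x. L2_rep A x + L2_rep B x)"

definition L2_scale ::
  "'p measure \<Rightarrow> real \<Rightarrow> ('p \<Rightarrow> 'v::euclidean_space) set \<Rightarrow> ('p \<Rightarrow> 'v) set" where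
  "L2_scale M c A = L2_class M (\<lambda>x. c *\<^sub>R L2_rep A x)"

definition L2_dist ::
  "'p measure \<Rightarrow> ('p \<Rightarrow> 'v::euclidean_space) set \<Rightarrow> ('p \<Rightarrow> 'v) set \<Rightarrow> real" where
  "L2_dist M A B = sqrt (LINT x|M. (norm (L2_rep A x - L2_rep B x))\<^sup>2)"

definition L2_topology :: "'p measure \<Rightarrow> ('p \<Rightarrow> 'v::euclidean_space) set topology" where
  "L2_topology M = Metric_space.mtopology (L2 M) (L2_dist M)"

text \<open>The operations do not depend on the representatives, and the distance is a metric.\<close>

lemma L2_fun_add:
  assumes "f \<in> L2_fun M" "g \<in> L2_fun M"
  shows "(\<lambda>x. f x + g x) \<in> L2_fun M"
proof -
  have [measurable]: "f \<in> borel_measurable M" "g \<in> borel_measurable M"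
    and int: "integrable M (\<lambda>x. (norm (f x))\<^sup>2)" "integrable M (\<lambda>x. (norm (g x))\<^sup>2)"
    using assms by (auto simp: L2_fun_def)
  have "integrable M (\<lambda>x. 2 * (norm (f x))\<^sup>2 + 2 * (norm (g x))\<^sup>2)"
    using int by auto
  then have "integrable M (\<lambda>x. (norm (f x + g x))\<^sup>2)"
  proof (rule Bochner_Integration.integrable_bound)
    have "(norm (f x + g x))\<^sup>2 \<le> 2 * (norm (f x))\<^sup>2 + 2 * (norm (g x))\<^sup>2" for x
    proof -
      have "(norm (f x + g x))\<^sup>2 \<le> (norm (f x) + norm (g x))\<^sup>2"
        by (simp add: norm_triangle_ineq power_mono)
      also have "\<dots> \<le> 2 * (norm (f x))\<^sup>2 + 2 * (norm (g x))\<^sup>2"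
        using sum_squares_bound[of "norm (f x)" "norm (g x)"] by (simp add: power2_sum)
      finally show ?thesis .
    qed
    then show "AE x in M. norm ((norm (f x + g x))\<^sup>2)
        \<le> norm (2 * (norm (f x))\<^sup>2 + 2 * (norm (g x))\<^sup>2)"
      by (intro AE_I2) simp
  qed measurable
  then show ?thesis by (simp add: L2_fun_def)
qed

lemma L2_fun_scale:
  assumes "f \<in> L2_fun M"
  shows "(\<lambda>x. c *\<^sub>R f x) \<in> L2_fun M"
  using assms by (auto simp: L2_fun_def power_mult_distrib)

lemma L2_fun_diff:
  assumes "f \<in> L2_fun M" "g \<in> L2_fun M"
  shows "(\<lambda>x. f x - g x) \<in> L2_fun M"
  using L2_fun_add[OF assms(1) L2_fun_scale[OF assms(2), of "-1"]] by simp

lemma L2_class_self: "f \<in> L2_fun M \<Longrightarrow> f \<in> L2_class M f"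
  by (simp add: L2_class_def)

lemma L2_class_eqI:
  assumes "AE x in M. f x = g x"
  shows "L2_class M f = L2_class M g"
proof -
  have "(AE x in M. h x = f x) \<longleftrightarrow> (AE x in M. h x = g x)" for h
    using assms by (auto elim: eventually_elim2)
  then show ?thesis by (simp add: L2_class_def)
qed

lemma L2_class_eq_iff:
  assumes "f \<in> L2_fun M"
  shows "L2_class M f = L2_class M g \<longleftrightarrow> (AE x in M. f x = g x)"
  using L2_class_self[OF assms] L2_class_eqI[of f g M] by (auto simp: L2_class_def)

lemma L2_rep_class:
  assumes "f \<in> L2_fun M"
  shows "L2_rep (L2_class M f) \<in> L2_fun M" "AE x in M. L2_rep (L2_class M f) x = f x"
proof -
  have "L2_rep (L2_class M f) \<in> L2_class M f"
    unfolding L2_rep_def by (rule someI[where P = "\<lambda>g. g \<in> L2_class M f"]) (rule L2_class_self[OF assms])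
  then show "L2_rep (L2_class M f) \<in> L2_fun M" "AE x in M. L2_rep (L2_class M f) x = f x"
    by (auto simp: L2_class_def)
qed

lemma L2_class_rep: "A \<in> L2 M \<Longrightarrow> L2_class M (L2_rep A) = A"
  unfolding L2_def using L2_class_eqI[OF L2_rep_class(2)] by blast

lemma L2_rep_in: "A \<in> L2 M \<Longrightarrow> L2_rep A \<in> L2_fun M"
  unfolding L2_def using L2_rep_class(1) by blast

lemma L2_add_class:
  assumes "f \<in> L2_fun M" "g \<in> L2_fun M"
  shows "L2_add M (L2_class M f) (L2_class M g) = L2_class M (\<lambda>x. f x + g x)"
  unfolding L2_add_def
  using L2_rep_class(2)[OF assms(1)] L2_rep_class(2)[OF assms(2)]
  by (intro L2_class_eqI) auto

lemma L2_scale_class: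
  assumes "f \<in> L2_fun M"
  shows "L2_scale M c (L2_class M f) = L2_class M (\<lambda>x. c *\<^sub>R f x)"
  unfolding L2_scale_def using L2_rep_class(2)[OF assms] by (intro L2_class_eqI) auto

lemma L2_dist_class:
  assumes f: "f \<in> L2_fun M" and g: "g \<in> L2_fun M"
  shows "L2_dist M (L2_class M f) (L2_class M g) = sqrt (LINT x|M. (norm (f x - g x))\<^sup>2)"
proof -
  have [measurable]: "f \<in> borel_measurable M" "g \<in> borel_measurable M"
    "L2_rep (L2_class M f) \<in> borel_measurable M" "L2_rep (L2_class M g) \<in> borel_measurable M"
    using f g L2_rep_class(1)[OF f] L2_rep_class(1)[OF g] by (auto simp: L2_fun_def)
  have "(LINT x|M. (norm (L2_rep (L2_class M f) x - L2_rep (L2_class M g) x))\<^sup>2) =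
      (LINT x|M. (norm (f x - g x))\<^sup>2)"
    by (rule integral_cong_AE) (use L2_rep_class(2)[OF f] L2_rep_class(2)[OF g] in auto)
  then show ?thesis by (simp add: L2_dist_def)
qed

lemma L2_integral_zero_iff:
  assumes "f \<in> L2_fun M"
  shows "(LINT x|M. (norm (f x))\<^sup>2) = 0 \<longleftrightarrow> (AE x in M. f x = 0)"
  using assms by (subst integral_nonneg_eq_0_iff_AE) (auto simp: L2_fun_def)

lemma L2_minkowski:
  assumes f: "f \<in> L2_fun M" and g: "g \<in> L2_fun M"
  shows "sqrt (LINT x|M. (norm (f x + g x))\<^sup>2)
    \<le> sqrt (LINT x|M. (norm (f x))\<^sup>2) + sqrt (LINT x|M. (norm (g x))\<^sup>2)"
proof -
  define F where "F = sqrt (LINT x|M. (norm (f x))\<^sup>2)"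
  define G where "G = sqrt (LINT x|M. (norm (g x))\<^sup>2)"
  have [measurable]: "f \<in> borel_measurable M" "g \<in> borel_measurable M"
    and int: "integrable M (\<lambda>x. (norm (f x))\<^sup>2)" "integrable M (\<lambda>x. (norm (g x))\<^sup>2)"
    using f g by (auto simp: L2_fun_def)
  have intfg: "integrable M (\<lambda>x. (norm (f x + g x))\<^sup>2)"
    using L2_fun_add[OF f g] by (simp add: L2_fun_def)
  have sq: "(LINT x|M. (norm (f x))\<^sup>2) = F\<^sup>2" "(LINT x|M. (norm (g x))\<^sup>2) = G\<^sup>2"
    by (simp_all add: F_def G_def)
  have nn: "F \<ge> 0" "G \<ge> 0" by (simp_all add: F_def G_def)
  consider "F = 0" | "G = 0" | "F > 0" "G > 0" using nn by linarith
  then show ?thesis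
  proof cases
    case 1
    then have "AE x in M. f x = 0" using sq L2_integral_zero_iff[OF f] by simp
    then have "(LINT x|M. (norm (f x + g x))\<^sup>2) = (LINT x|M. (norm (g x))\<^sup>2)"
      by (intro integral_cong_AE) auto
    then show ?thesis by simp
  next
    case 2
    then have "AE x in M. g x = 0" using sq L2_integral_zero_iff[OF g] by simp
    then have "(LINT x|M. (norm (f x + g x))\<^sup>2) = (LINT x|M. (norm (f x))\<^sup>2)"
      by (intro integral_cong_AE) auto
    then show ?thesis by simp
  next
    case 3
    have "(LINT x|M. (norm (f x + g x))\<^sup>2)
        \<le> (LINT x|M. (1 + G / F) * (norm (f x))\<^sup>2 + (1 + F / G) * (norm (g x))\<^sup>2)"
    proof (rule integral_mono)
      fix x
      define p q where "p = norm (f x)" and "q = norm (g x)"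
      have "(norm (f x + g x))\<^sup>2 \<le> (p + q)\<^sup>2"
        by (simp add: p_def q_def norm_triangle_ineq power_mono)
      also have "\<dots> \<le> (1 + G / F) * p\<^sup>2 + (1 + F / G) * q\<^sup>2"
      proof -
        have "0 \<le> (G * p - F * q)\<^sup>2 / (F * G)" using 3 by simp
        also have "\<dots> = G / F * p\<^sup>2 + F / G * q\<^sup>2 - 2 * p * q"
          using 3 by (simp add: power2_eq_square field_simps)
        finally show ?thesis by (simp add: power2_sum algebra_simps)
      qed
      finally show "(norm (f x + g x))\<^sup>2
          \<le> (1 + G / F) * (norm (f x))\<^sup>2 + (1 + F / G) * (norm (g x))\<^sup>2"
        by (simp add: p_def q_def)
    qed (use int intfg in auto)
    also have "\<dots> = (1 + G / F) * F\<^sup>2 + (1 + F / G) * G\<^sup>2"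
      using int by (simp add: sq)
    also have "\<dots> = (F + G)\<^sup>2"
      using 3 by (simp add: power2_eq_square field_simps)
    finally show ?thesis
      using nn by (simp flip: F_def G_def add: real_le_lsqrt)
  qed
qed

lemma Metric_space_L2:
  fixes M :: "'p measure"
  shows "Metric_space (L2 M :: ('p \<Rightarrow> 'v::euclidean_space) set set) (L2_dist M)"
proof
  show "0 \<le> L2_dist M A B" "L2_dist M A B = L2_dist M B A" for A B :: "('p \<Rightarrow> 'v) set"
    by (simp_all add: L2_dist_def norm_minus_commute)
  fix A B :: "('p \<Rightarrow> 'v) set"
  assume A: "A \<in> L2 M" and B: "B \<in> L2 M"
  show "L2_dist M A B = 0 \<longleftrightarrow> A = B"
    using L2_integral_zero_iff[OF L2_fun_diff[OF L2_rep_in[OF A] L2_rep_in[OF B]]]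
      L2_class_eq_iff[OF L2_rep_in[OF A], of "L2_rep B"]
    by (simp add: L2_dist_def L2_class_rep[OF A] L2_class_rep[OF B])
  fix C :: "('p \<Rightarrow> 'v) set" assume C: "C \<in> L2 M"
  show "L2_dist M A C \<le> L2_dist M A B + L2_dist M B C"
    using L2_minkowski[OF L2_fun_diff[OF L2_rep_in[OF A] L2_rep_in[OF B]]
        L2_fun_diff[OF L2_rep_in[OF B] L2_rep_in[OF C]]]
    by (simp add: L2_dist_def)
qed


section \<open>Unbounded linear operators and closability\<close>

text \<open>
  An operator is given by its domain \<open>D\<close> and a function \<open>T\<close> on classes, whose values outside
  \<open>D\<close> are irrelevant.
\<close>

definition L2_subspace :: "'p measure \<Rightarrow> ('p \<Rightarrow> 'v::euclidean_space) set set \<Rightarrow> bool" where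
  "L2_subspace M D \<longleftrightarrow> D \<subseteq> L2 M \<and> L2_zero M \<in> D \<and>
    (\<forall>A\<in>D. \<forall>B\<in>D. L2_add M A B \<in> D) \<and> (\<forall>c. \<forall>A\<in>D. L2_scale M c A \<in> D)"

definition linear_operator ::
  "'p measure \<Rightarrow> ('p \<Rightarrow> 'v::euclidean_space) set set \<Rightarrow>
   (('p \<Rightarrow> 'v) set \<Rightarrow> ('p \<Rightarrow> 'w::euclidean_space) set) \<Rightarrow> bool" where
  "linear_operator M D T \<longleftrightarrow> L2_subspace M D \<and> (\<forall>A\<in>D. T A \<in> L2 M) \<and>
    (\<forall>A\<in>D. \<forall>B\<in>D. T (L2_add M A B) = L2_add M (T A) (T B)) \<and>
    (\<forall>c. \<forall>A\<in>D. T (L2_scale M c A) = L2_scale M c (T A))"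

definition densely_defined ::
  "'p measure \<Rightarrow> ('p \<Rightarrow> 'v::euclidean_space) set set \<Rightarrow> bool" where
  "densely_defined M D \<longleftrightarrow> L2_topology M closure_of D = L2 M"

definition operator_graph :: "'x set \<Rightarrow> ('x \<Rightarrow> 'y) \<Rightarrow> ('x \<times> 'y) set" where
  "operator_graph D T = {(A, T A) | A. A \<in> D}"

definition closable ::
  "'p measure \<Rightarrow> ('p \<Rightarrow> 'v::euclidean_space) set set \<Rightarrow>
   (('p \<Rightarrow> 'v) set \<Rightarrow> ('p \<Rightarrow> 'w::euclidean_space) set) \<Rightarrow> bool" where
  "closable M D T \<longleftrightarrow>
    (\<exists>D' T'. linear_operator M D' (T' :: ('p \<Rightarrow> 'v) set \<Rightarrow> ('p \<Rightarrow> 'w) set) \<and>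
       prod_topology (L2_topology M) (L2_topology M) closure_of operator_graph D T
         = operator_graph D' T')"


section \<open>The curl operator\<close>

fun C_k :: "nat \<Rightarrow> ('a::real_normed_vector \<Rightarrow> 'b::real_normed_vector) \<Rightarrow> bool" where
  "C_k 0 f \<longleftrightarrow> continuous_on UNIV f"
| "C_k (Suc k) f \<longleftrightarrow> (\<forall>x. f differentiable (at x)) \<and>
     (\<forall>v. C_k k (\<lambda>x. frechet_derivative f (at x) v))"

definition smooth :: "('a::real_normed_vector \<Rightarrow> 'b::real_normed_vector) \<Rightarrow> bool" where
  "smooth f \<longleftrightarrow> (\<forall>k. C_k k f)"

definition curl :: "(real \<times> real \<Rightarrow> real \<times> real) \<Rightarrow> real \<times> real \<Rightarrow> real" where
  "curl u = (\<lambda>(x, y). deriv (\<lambda>t. snd (u (t, y))) x - deriv (\<lambda>t. fst (u (x, t))) y)"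

text \<open>
  The domain of a curl operator on \<open>S\<close> is not prescribed, and neither is the action of the
  operator on those elements of its domain that are not classes of smooth vector fields.
\<close>

definition is_curl_operator ::
  "(real \<times> real) set \<Rightarrow> (real \<times> real \<Rightarrow> real \<times> real) set set \<Rightarrow>
   ((real \<times> real \<Rightarrow> real \<times> real) set \<Rightarrow> (real \<times> real \<Rightarrow> real) set) \<Rightarrow> bool" where
  "is_curl_operator S D T \<longleftrightarrow>
    linear_operator (lebesgue_on S) D T \<and> densely_defined (lebesgue_on S) D \<and>
    (\<forall>u. smooth u \<longrightarrow> L2_class (lebesgue_on S) u \<in> D \<longrightarrow>
       T (L2_class (lebesgue_on S) u) = L2_class (lebesgue_on S) (curl u))"

end

theory Submission
  imports Defs
begin

text \<open>
  A closable linear operator cannot have inputs tending to \<open>0\<close> whose images tend to something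
  nonzero.  Hence it is enough to find smooth fields \<open>u\<^sub>n\<close> that tend to \<open>0\<close> uniformly on the carpet
  \<open>S\<close> while \<open>curl u\<^sub>n\<close> tends uniformly to the constant \<open>1\<close>; since \<open>S\<close> has positive area, that
  constant is not the zero of \<open>L\<^sup>2(S)\<close>.  On a full square no such sequence exists:
  by Stokes' theorem the integral of \<open>curl u\<^sub>n\<close> over the square is the circulation along its boundary,
  which tends to \<open>0\<close>.  On the carpet a compensating negative amount of curl can be hidden in the holes.

  Let \<open>s\<close> be the side of the squares of generation \<open>n\<close>, so that each of them loses a central square
  of side \<open>s a\<^sub>n\<^sub>+\<^sub>1\<close>.  Let \<open>t\<close> be an \<open>s\<close>-periodic function on the line with mean \<open>1\<close>, supported in the
  central intervals of relative length \<open>a\<^sub>n\<^sub>+\<^sub>1\<close>, with \<open>t \<le> 2 / a\<^sub>n\<^sub>+\<^sub>1\<close>, and let \<open>P\<close> be a primitive of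
  \<open>1 - t\<close>; since \<open>t\<close> has mean \<open>1\<close>, one can take \<open>P = O(s)\<close>.  The field \<open>u(x, y) = (- t(x) P(y), P(x))\<close>
  satisfies \<open>curl u = 1 - t(x) + t(x) (1 - t(y)) = 1 - t(x) t(y)\<close>.  The product \<open>t(x) t(y)\<close> lives on the
  holes, so \<open>curl u = 1\<close> on \<open>S\<close>, and \<open>u = O(s / a\<^sub>n\<^sub>+\<^sub>1)\<close>, which tends to \<open>0\<close> by hypothesis.

  Smoothness costs nothing: by the Weierstrass theorem \<open>t\<close> is uniformly close on \<open>[0, 1]\<close> to a
  polynomial \<open>p\<close>, and replacing \<open>t\<close> by \<open>p\<close> (and \<open>P\<close> by a primitive of \<open>1 - p\<close>) keeps the identity
  \<open>curl u = 1 - p(x) p(y)\<close> and changes the estimates by an arbitrarily small amount.  This is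
  \<open>small_field_with_curl_near_1\<close>.

  The area of \<open>S\<close> is positive (\<open>carpet_not_null\<close>) because the squares removed from the corner square
  \<open>[0, s\<^sub>M]\<^sup>2\<close> in all later generations have total area at most \<open>s\<^sub>M\<^sup>2\<close> times a tail of \<open>\<Sum> a\<^sub>i\<^sup>2\<close>, and
  that tail is smaller than \<open>1\<close> for large \<open>M\<close>.
\<close>

section \<open>A staircase function and its derivative\<close>

text \<open>
  A tent over the unit interval with integral \<open>1\<close>.  Writing it with positive parts makes its primitive
  \<open>ramp\<close>, a continuously differentiable step from \<open>0\<close> to \<open>1\<close>, a single formula.
\<close>

definition tent :: "real \<Rightarrow> real" where
  "tent z = 4 * (max 0 z - 2 * max 0 (z - 1/2) + max 0 (z - 1))"

definition ramp :: "real \<Rightarrow> real" where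
  "ramp z = 2 * ((max 0 z)\<^sup>2 - 2 * (max 0 (z - 1/2))\<^sup>2 + (max 0 (z - 1))\<^sup>2)"

lemma tent_bounds: "0 \<le> tent z" "tent z \<le> 2"
  by (auto simp: tent_def max_def)

lemma tent_eq_0: "z \<le> 0 \<or> 1 \<le> z \<Longrightarrow> tent z = 0"
  by (auto simp: tent_def max_def)

lemma continuous_tent: "continuous_on A tent"
  unfolding tent_def by (intro continuous_intros)

lemma ramp_eq_0: "z \<le> 0 \<Longrightarrow> ramp z = 0"
  by (auto simp: ramp_def max_def)

lemma ramp_eq_1: "1 \<le> z \<Longrightarrow> ramp z = 1"
  by (auto simp: ramp_def max_def power2_eq_square algebra_simps)

lemma DERIV_max_0_squared: "((\<lambda>z::real. (max 0 z)\<^sup>2) has_real_derivative 2 * max 0 z) (at z)"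
proof -
  consider "z < 0" | "z = 0" | "z > 0" by linarith
  then show ?thesis
  proof cases
    case 1
    have "((\<lambda>z::real. 0) has_real_derivative 0) (at z)" by simp
    then have "((\<lambda>z::real. (max 0 z)\<^sup>2) has_real_derivative 0) (at z)"
      by (rule has_field_derivative_transform_within_open[of _ _ _ "{..<0}"]) (use 1 in auto)
    then show ?thesis using 1 by simp
  next
    case 2
    have "((\<lambda>z::real. max 0 z) \<longlongrightarrow> 0) (at 0)"
      using tendsto_max[OF tendsto_const[of 0] tendsto_ident_at[of "0::real" UNIV]] by simp
    then have "((\<lambda>h::real. (max 0 h)\<^sup>2 / h) \<longlongrightarrow> 0) (at 0)"
      by (rule Lim_transform_eventually)
         (auto simp: eventually_at_filter max_def power2_eq_square intro!: always_eventually)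
    then show ?thesis using 2 by (simp add: DERIV_def)
  next
    case 3
    have "((\<lambda>z::real. z\<^sup>2) has_real_derivative 2 * z) (at z)"
      by (auto intro!: derivative_eq_intros)
    then have "((\<lambda>z::real. (max 0 z)\<^sup>2) has_real_derivative 2 * z) (at z)"
      by (rule has_field_derivative_transform_within_open[of _ _ _ "{0<..}"]) (use 3 in auto)
    then show ?thesis using 3 by simp
  qed
qed

lemma DERIV_ramp: "(ramp has_real_derivative tent z) (at z)"
proof -
  have "((\<lambda>z::real. (max 0 (z - c))\<^sup>2) has_real_derivative 2 * max 0 (z - c)) (at z)" for c
    using DERIV_chain2[OF DERIV_max_0_squared DERIV_diff[OF DERIV_ident DERIV_const], of c z UNIV] by simp
  note D = this[of 0, simplified] this[of "1/2"] this[of 1]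
  show ?thesis
    unfolding ramp_def[abs_def] tent_def
    by (rule DERIV_cong[OF DERIV_cmult[OF DERIV_add[OF DERIV_diff[OF D(1) DERIV_cmult[OF D(2)]] D(3)]]])
       simp
qed

lemma ramp_mono: "x \<le> y \<Longrightarrow> ramp x \<le> ramp y"
  by (rule DERIV_nonneg_imp_nondecreasing) (use DERIV_ramp tent_bounds(1) in blast)+

lemma ramp_bounds: "0 \<le> ramp z" "ramp z \<le> 1"
  using ramp_mono[of "min z 0" z] ramp_mono[of z "max z 1"] ramp_eq_0[of "min z 0"] ramp_eq_1[of "max z 1"]
  by auto

text \<open>
  The cells are the intervals \<open>[k / N, (k + 1) / N]\<close>.  The staircase climbs by \<open>1 / N\<close> in each of them,
  entirely within the central part of relative length \<open>r\<close>; its derivative \<open>comb\<close> is therefore a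
  periodic function of mean \<open>1\<close> supported in these central parts.
\<close>

definition staircase :: "nat \<Rightarrow> real \<Rightarrow> real \<Rightarrow> real" where
  "staircase N r x = (\<Sum>k<N. ramp ((real N * x - real k - 1/2) / r + 1/2)) / real N"

definition comb :: "nat \<Rightarrow> real \<Rightarrow> real \<Rightarrow> real" where
  "comb N r x = (\<Sum>k<N. tent ((real N * x - real k - 1/2) / r + 1/2)) / r"

lemma continuous_comb: "r > 0 \<Longrightarrow> continuous_on A (comb N r)"
  unfolding comb_def
  by (intro continuous_intros continuous_on_compose2[OF continuous_tent[of UNIV]]) auto

lemma DERIV_staircase:
  assumes "N > 0" "r > 0"
  shows "(staircase N r has_real_derivative comb N r x) (at x)"
proof -
  have "((\<lambda>x. ramp ((real N * x - real k - 1/2) / r + 1/2)) has_real_derivative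
      tent ((real N * x - real k - 1/2) / r + 1/2) * (real N / r)) (at x)" for k
    by (rule DERIV_chain2[OF DERIV_ramp]) (use assms in \<open>auto intro!: derivative_eq_intros\<close>)
  then have "((\<lambda>x. (\<Sum>k<N. ramp ((real N * x - real k - 1/2) / r + 1/2)) / real N) has_real_derivative
      (\<Sum>k<N. tent ((real N * x - real k - 1/2) / r + 1/2) * (real N / r)) / real N) (at x)"
    by (intro DERIV_cdivide DERIV_sum)
  moreover have "(\<Sum>k<N. tent ((real N * x - real k - 1/2) / r + 1/2) * (real N / r)) / real N = comb N r x"
    unfolding comb_def sum_distrib_right[symmetric] using assms(1) by simp
  ultimately show ?thesis
    unfolding staircase_def[abs_def] by simp
qed

lemma comb_nonzero_imp:
  assumes "comb N r x \<noteq> 0" "r > 0"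
  obtains k where "k < N" "\<bar>real N * x - real k - 1/2\<bar> < r / 2"
proof -
  have "(\<Sum>k<N. tent ((real N * x - real k - 1/2) / r + 1/2)) \<noteq> 0"
    using assms(1) unfolding comb_def by auto
  then obtain k where k: "k < N" "tent ((real N * x - real k - 1/2) / r + 1/2) \<noteq> 0"
    by (meson lessThan_iff sum.neutral)
  have "0 < (real N * x - real k - 1/2) / r + 1/2" "(real N * x - real k - 1/2) / r + 1/2 < 1"
    using k(2) tent_eq_0 by (meson not_le)+
  then have "\<bar>real N * x - real k - 1/2\<bar> < r / 2"
    using \<open>r > 0\<close> by (auto simp: field_simps abs_less_iff)
  with k(1) show thesis by (rule that)
qed

text \<open>
  The tents have disjoint supports, so that only the tent of the cell of \<open>x\<close> contributes.
\<close>

lemma comb_bounds: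
  assumes "0 < r" "r \<le> 1"
  shows "0 \<le> comb N r x" "comb N r x \<le> 2 / r"
proof -
  show "0 \<le> comb N r x"
    unfolding comb_def using assms tent_bounds by (auto intro!: sum_nonneg divide_nonneg_pos)
  have "(\<Sum>k<N. tent ((real N * x - real k - 1/2) / r + 1/2)) \<le> 2"
  proof -
    define j where "j = nat \<lfloor>real N * x\<rfloor>"
    have "tent ((real N * x - real k - 1/2) / r + 1/2) \<le> (if k = j then 2 else 0)" for k
    proof (cases "k = j")
      case False
      then consider "real N * x \<le> real k" | "real N * x \<ge> real k + 1"
        unfolding j_def by linarith
      then have "(real N * x - real k - 1/2) / r + 1/2 \<le> 0 \<or> 1 \<le> (real N * x - real k - 1/2) / r + 1/2"
        by cases (use assms in \<open>auto simp: field_simps\<close>)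
      then show ?thesis using False tent_eq_0 by simp
    qed (use tent_bounds in auto)
    then have "(\<Sum>k<N. tent ((real N * x - real k - 1/2) / r + 1/2)) \<le> (\<Sum>k<N. if k = j then 2 else 0)"
      by (intro sum_mono)
    also have "\<dots> \<le> 2" by simp
    finally show ?thesis .
  qed
  then show "comb N r x \<le> 2 / r"
    unfolding comb_def using assms by (intro divide_right_mono) auto
qed

text \<open>
  At the ends of each cell the staircase agrees with the identity, and both increase by \<open>1 / N\<close> over the
  cell.
\<close>

lemma staircase_close:
  assumes "0 < r" "r \<le> 1" "N > 0" "0 \<le> x" "x \<le> 1"
  shows "\<bar>x - staircase N r x\<bar> \<le> 1 / real N"
proof -
  let ?f = "\<lambda>k. ramp ((real N * x - real k - 1/2) / r + 1/2)"
  define j where "j = nat \<lfloor>real N * x\<rfloor>"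
  have j: "real j \<le> real N * x" "real N * x < real j + 1"
    using assms(4) unfolding j_def by (simp_all add: zero_le_mult_iff)
  have "real N * x \<le> real N" using assms by (simp add: mult_left_le)
  then have jN: "j \<le> N" using j(1) by linarith
  have lower: "(if k \<in> {..<j} then 1 else 0) \<le> ?f k" for k
  proof (cases "k < j")
    case True
    then have "real k + 1 \<le> real N * x" using j by linarith
    then have "1 \<le> (real N * x - real k - 1/2) / r + 1/2"
      using assms by (simp add: field_simps)
    then show ?thesis using ramp_eq_1 by simp
  qed (use ramp_bounds in auto)
  have upper: "?f k \<le> (if k \<in> {..j} then 1 else 0)" for k
  proof (cases "k \<le> j")
    case False
    then have "real N * x \<le> real k" using j by linarith
    then have "(real N * x - real k - 1/2) / r + 1/2 \<le> 0"
      using assms by (simp add: field_simps)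
    then show ?thesis using ramp_eq_0 False by simp
  qed (use ramp_bounds in auto)
  have "real j = (\<Sum>k<N. if k \<in> {..<j} then 1 else 0)"
  proof -
    have "{..<N} \<inter> {..<j} = {..<j}" using jN by auto
    then show ?thesis
      using sum.inter_restrict[of "{..<N}" "\<lambda>_. 1::real" "{..<j}"] by simp
  qed
  also have "\<dots> \<le> (\<Sum>k<N. ?f k)" using lower by (rule sum_mono)
  finally have 1: "real j \<le> (\<Sum>k<N. ?f k)" .
  have "(\<Sum>k<N. ?f k) \<le> (\<Sum>k<N. if k \<in> {..j} then 1 else 0)" using upper by (rule sum_mono)
  also have "\<dots> = real (card ({..<N} \<inter> {..j}))" using sum.inter_restrict[of "{..<N}" "\<lambda>_. 1::real" "{..j}"] by simp
  also have "\<dots> \<le> real (card {..j})" by (intro of_nat_mono card_mono) auto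
  finally have 2: "(\<Sum>k<N. ?f k) \<le> real j + 1" by simp
  have "\<bar>real N * x - (\<Sum>k<N. ?f k)\<bar> \<le> 1" using 1 2 j by linarith
  then have "\<bar>real N * x - (\<Sum>k<N. ?f k)\<bar> / real N \<le> 1 / real N" by (rule divide_right_mono) simp
  moreover have "\<bar>real N * x - (\<Sum>k<N. ?f k)\<bar> / real N = \<bar>(real N * x - (\<Sum>k<N. ?f k)) / real N\<bar>"
    by simp
  moreover have "(real N * x - (\<Sum>k<N. ?f k)) / real N = x - staircase N r x"
    using assms(3) unfolding staircase_def diff_divide_distrib by simp
  ultimately show ?thesis by simp
qed

section \<open>Polynomial approximation and polynomial fields\<close>

lemma real_polynomial_function_antiderivative:
  fixes p :: "real \<Rightarrow> real"
  assumes "real_polynomial_function p"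
  obtains q where "real_polynomial_function q" "\<And>x. (q has_real_derivative p x) (at x)"
proof -
  obtain c n where p: "p = (\<lambda>x. \<Sum>i\<le>n. c i * x ^ i)"
    using assms real_polynomial_function_iff_sum by blast
  show thesis
  proof (rule that)
    show "real_polynomial_function (\<lambda>x. \<Sum>i\<le>n. c i / real (Suc i) * x ^ Suc i)"
      by (intro real_polynomial_function_sum real_polynomial_function.intros(4)
          real_polynomial_function_power) (auto intro: real_polynomial_function.intros bounded_linear_ident)
    have "((\<lambda>x. c i / real (Suc i) * x ^ Suc i) has_real_derivative c i * x ^ i) (at x)" for i x
      using DERIV_cmult[OF DERIV_pow[of "Suc i" x], of "c i / real (Suc i)"] by simp
    then show "((\<lambda>x. \<Sum>i\<le>n. c i / real (Suc i) * x ^ Suc i) has_real_derivative p x) (at x)" for x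
      unfolding p by (intro DERIV_sum)
  qed
qed

text \<open>
  Here \<open>p\<close> approximates \<open>comb N r\<close> uniformly.  The polynomial \<open>P\<close> is the primitive of \<open>1 - p\<close> with the
  same value at \<open>0\<close> as \<open>x - staircase N r x\<close>; it stays within \<open>e\<close> of that function on the
  unit interval because the derivatives differ by at most \<open>e\<close>.
\<close>

lemma polynomial_comb:
  assumes r: "0 < r" "r \<le> 1" and N: "N > 0" and e: "e > 0"
  obtains p P where "real_polynomial_function p" "real_polynomial_function P"
    "\<And>x. (P has_real_derivative 1 - p x) (at x)"
    "\<And>x. x \<in> {0..1} \<Longrightarrow> \<bar>p x - comb N r x\<bar> \<le> e"
    "\<And>x. x \<in> {0..1} \<Longrightarrow> \<bar>P x\<bar> \<le> 1 / real N + e"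
proof -
  obtain p where p: "real_polynomial_function p"
    and pe: "\<And>x. x \<in> {0..1} \<Longrightarrow> \<bar>comb N r x - p x\<bar> < e"
    using Stone_Weierstrass_real_polynomial_function[of "{0..1}" "comb N r" e] continuous_comb[OF r(1)] e
    by auto
  obtain q where q: "real_polynomial_function q" "\<And>x. (q has_real_derivative p x) (at x)"
    using real_polynomial_function_antiderivative[OF p] by blast
  define c where "c = staircase N r 0 - q 0"
  define P where "P x = x - q x - c" for x
  have close: "\<bar>staircase N r x - q x - c\<bar> \<le> e" if "x \<in> {0..1}" for x
  proof -
    have "norm ((staircase N r x - q x) - (staircase N r 0 - q 0)) \<le> e * norm (x - 0)"
    proof (rule field_differentiable_bound[where S = "{0..1}"])
      show "((\<lambda>x. staircase N r x - q x) has_field_derivative comb N r z - p z) (at z within {0..1})" for z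
        by (intro has_field_derivative_at_within[OF DERIV_diff] DERIV_staircase N r q)
      show "norm (comb N r z - p z) \<le> e" if "z \<in> {0..1}" for z
        using pe[OF that] by simp
    qed (use that in auto)
    also have "\<dots> \<le> e * 1" using that e by (intro mult_left_mono) auto
    finally show ?thesis by (simp add: c_def)
  qed
  show thesis
  proof (rule that[OF p])
    show "real_polynomial_function P"
      unfolding P_def
      by (intro real_polynomial_function_diff q(1) real_polynomial_function.intros(1)[OF bounded_linear_ident]
          real_polynomial_function.intros(2))
    show "(P has_real_derivative 1 - p x) (at x)" for x
      unfolding P_def by (auto intro!: derivative_eq_intros q(2))
    show "\<bar>p x - comb N r x\<bar> \<le> e" if "x \<in> {0..1}" for x
      using pe[OF that] by linarith
    show "\<bar>P x\<bar> \<le> 1 / real N + e" if "x \<in> {0..1}" for x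
      using close[OF that] staircase_close[OF r N, of x] that unfolding P_def by auto
  qed
qed

lemma real_polynomial_function_has_derivative:
  assumes "real_polynomial_function f"
  shows "\<exists>f'. (\<forall>x. (f has_derivative f' x) (at x)) \<and> (\<forall>v. real_polynomial_function (\<lambda>x. f' x v))"
  using assms
proof induction
  case (linear f)
  then show ?case
    by (intro exI[of _ "\<lambda>_. f"]) (simp add: bounded_linear_imp_has_derivative real_polynomial_function.intros(2))
next
  case (const c)
  show ?case
    by (intro exI[of _ "\<lambda>_ _. 0"]) (simp add: real_polynomial_function.intros(2))
next
  case (add f g)
  obtain f' where "\<And>x. (f has_derivative f' x) (at x)" "\<And>v. real_polynomial_function (\<lambda>x. f' x v)"
    using add.IH(1) by blast
  moreover obtain g' where "\<And>x. (g has_derivative g' x) (at x)" "\<And>v. real_polynomial_function (\<lambda>x. g' x v)"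
    using add.IH(2) by blast
  ultimately show ?case
    by (intro exI[of _ "\<lambda>x v. f' x v + g' x v"])
       (simp add: has_derivative_add real_polynomial_function.intros(3))
next
  case (mult f g)
  obtain f' where "\<And>x. (f has_derivative f' x) (at x)" "\<And>v. real_polynomial_function (\<lambda>x. f' x v)"
    using mult.IH(1) by blast
  moreover obtain g' where "\<And>x. (g has_derivative g' x) (at x)" "\<And>v. real_polynomial_function (\<lambda>x. g' x v)"
    using mult.IH(2) by blast
  ultimately show ?case using mult.hyps
    by (intro exI[of _ "\<lambda>x v. f x * g' x v + f' x v * g x"])
       (simp add: has_derivative_mult real_polynomial_function.intros(3,4))
qed

text \<open>
  The directional derivatives of polynomials are polynomials, so the induction over the order of
  differentiability reproduces its hypothesis.
\<close>

lemma real_polynomial_function_smooth_pair: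
  fixes f g :: "'a::euclidean_space \<Rightarrow> real"
  assumes "real_polynomial_function f" "real_polynomial_function g"
  shows "smooth (\<lambda>x. (f x, g x))"
  unfolding smooth_def
proof
  fix k
  show "C_k k (\<lambda>x. (f x, g x))"
    using assms
  proof (induction k arbitrary: f g)
    case 0
    then show ?case
      by (simp add: continuous_on_Pair continuous_on_polymonial_function real_polynomial_function_eq)
  next
    case (Suc k)
    obtain f' where f': "\<And>x. (f has_derivative f' x) (at x)" "\<And>v. real_polynomial_function (\<lambda>x. f' x v)"
      using real_polynomial_function_has_derivative[OF Suc.prems(1)] by blast
    obtain g' where g': "\<And>x. (g has_derivative g' x) (at x)" "\<And>v. real_polynomial_function (\<lambda>x. g' x v)"
      using real_polynomial_function_has_derivative[OF Suc.prems(2)] by blast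
    have d: "((\<lambda>x. (f x, g x)) has_derivative (\<lambda>v. (f' x v, g' x v))) (at x)" for x
      using f'(1) g'(1) by (rule has_derivative_Pair)
    show ?case
      using d Suc.IH[OF f'(2) g'(2)] unfolding C_k.simps frechet_derivative_at[OF d, symmetric]
      by (blast intro: differentiableI)
  qed
qed

lemma real_polynomial_function_compose_linear:
  fixes p :: "real \<Rightarrow> real"
  assumes "real_polynomial_function p" "bounded_linear l"
  shows "real_polynomial_function (\<lambda>z. p (l z))"
  using assms(1)
proof induction
  case (linear f)
  then show ?case
    by (intro real_polynomial_function.intros(1) bounded_linear_compose[OF _ assms(2)])
qed (simp_all add: real_polynomial_function.intros)

text \<open>
  The curl is \<open>(1 - p x) + p x (1 - p y)\<close>, in which \<open>p x\<close> cancels.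
\<close>

lemma product_field:
  fixes p P :: "real \<Rightarrow> real"
  assumes p: "real_polynomial_function p" and P: "real_polynomial_function P"
    and D: "\<And>x. (P has_real_derivative 1 - p x) (at x)"
  defines "u \<equiv> \<lambda>z::real \<times> real. (- (p (fst z) * P (snd z)), P (fst z))"
  shows "smooth u" "curl u = (\<lambda>(x, y). 1 - p x * p y)"
proof -
  note lin = real_polynomial_function_compose_linear[OF _ bounded_linear_fst]
    real_polynomial_function_compose_linear[OF _ bounded_linear_snd]
  have "real_polynomial_function (\<lambda>z::real \<times> real. - (p (fst z) * P (snd z)))"
    by (intro real_polynomial_function_minus real_polynomial_function.intros(4)) (rule lin p P)+
  then show "smooth u" unfolding u_def
    by (rule real_polynomial_function_smooth_pair) (rule lin P)+
  have "((\<lambda>t. - (p x * P t)) has_real_derivative - (p x * (1 - p y))) (at y)" for x y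
    by (auto intro!: derivative_eq_intros D)
  note d = DERIV_imp_deriv[OF this] DERIV_imp_deriv[OF D]
  show "curl u = (\<lambda>(x, y). 1 - p x * p y)"
    by (rule ext, simp add: curl_def u_def d split_beta, simp add: algebra_simps)
qed

section \<open>The grid of a carpet and its holes\<close>

locale carpet_ratios =
  fixes a :: "nat \<Rightarrow> real"
  assumes odd_inverse: "\<And>i. i \<ge> 1 \<Longrightarrow> \<exists>k::int. odd k \<and> k > 1 \<and> 1 / a i = of_int k"
begin

text \<open>
  \<open>subdiv i\<close> is the odd integer \<open>1 / a i\<close>, and the squares of generation \<open>m\<close> belong to the grid that
  divides the unit square into \<open>grid m\<close> rows and columns.
\<close>

definition subdiv :: "nat \<Rightarrow> nat" where "subdiv i = nat \<lfloor>1 / a i\<rfloor>"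

definition grid :: "nat \<Rightarrow> nat" where "grid m = (\<Prod>k = 1..m. subdiv k)"

abbreviation side :: "nat \<Rightarrow> real" where "side \<equiv> carpet_side a"

lemma subdiv:
  assumes "i \<ge> 1"
  shows "real (subdiv i) = 1 / a i" "odd (subdiv i)" "subdiv i > 1"
proof -
  obtain k where k: "odd k" "k > 1" "1 / a i = of_int k" using odd_inverse[OF assms] by blast
  then have "subdiv i = nat k" by (simp add: subdiv_def)
  then show "real (subdiv i) = 1 / a i" "odd (subdiv i)" "subdiv i > 1" using k by (auto simp: even_nat_iff)
qed

lemma a_eq: "a (Suc m) = 1 / real (subdiv (Suc m))"
  using subdiv(1)[of "Suc m"] by simp

lemma subdiv_pos: "0 < subdiv (Suc m)" and a_pos: "0 < a (Suc m)" and a_le_1: "a (Suc m) \<le> 1"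
  using subdiv(3)[of "Suc m"] by (auto simp: a_eq)

lemma grid_Suc: "grid (Suc m) = grid m * subdiv (Suc m)"
  by (simp add: grid_def)

lemma grid_pos: "0 < grid m"
  by (induction m) (auto simp: grid_Suc subdiv_pos, simp add: grid_def)

lemma side_eq: "side m = 1 / real (grid m)"
proof (induction m)
  case (Suc m)
  have "side (Suc m) = side m * a (Suc m)" by (simp add: carpet_side_def)
  then show ?case using Suc by (simp add: grid_Suc a_eq)
qed (simp add: carpet_side_def grid_def)

lemma side_refine: "side m = real (subdiv (Suc m)) * side (Suc m)"
  using subdiv_pos[of m] by (simp add: side_eq grid_Suc)

lemma side_pos: "0 < side m"
  using grid_pos[of m] by (simp add: side_eq)

lemma corner_Suc_iff:
  "z \<in> carpet_corners a (Suc m) \<longleftrightarrow> (\<exists>x y i j. (x, y) \<in> carpet_corners a m \<and>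
     i < subdiv (Suc m) \<and> j < subdiv (Suc m) \<and> \<not> (2 * i + 1 = subdiv (Suc m) \<and> 2 * j + 1 = subdiv (Suc m)) \<and>
     z = (x + real i * side (Suc m), y + real j * side (Suc m)))"
proof -
  have "real i < 1 / a (Suc m) \<longleftrightarrow> i < subdiv (Suc m)"
    "2 * real i + 1 = 1 / a (Suc m) \<longleftrightarrow> 2 * i + 1 = subdiv (Suc m)" for i
    by (simp_all add: subdiv(1)[symmetric]) (metis of_nat_Suc of_nat_eq_iff of_nat_mult of_nat_numeral add.commute)
  then show ?thesis unfolding carpet_corners.simps by blast
qed

lemma corner_grid:
  assumes "z \<in> carpet_corners a m"
  obtains i j where "i < grid m" "j < grid m" "z = (real i * side m, real j * side m)"
proof -
  have "\<exists>i j. i < grid m \<and> j < grid m \<and> z = (real i * side m, real j * side m)"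
    using assms
  proof (induction m arbitrary: z)
    case 0
    then show ?case by (auto simp: grid_def)
  next
    case (Suc m)
    then obtain x y i' j' where c: "(x, y) \<in> carpet_corners a m" "i' < subdiv (Suc m)" "j' < subdiv (Suc m)"
      "z = (x + real i' * side (Suc m), y + real j' * side (Suc m))"
      unfolding corner_Suc_iff by blast
    obtain i j where ij: "i < grid m" "j < grid m" "x = real i * side m" "y = real j * side m"
      using Suc.IH[OF c(1)] by auto
    have lt: "k * subdiv (Suc m) + k' < grid (Suc m)" if "k < grid m" "k' < subdiv (Suc m)" for k k'
    proof -
      have "Suc k * subdiv (Suc m) \<le> grid m * subdiv (Suc m)" using that(1) by (intro mult_right_mono) auto
      then show ?thesis using that(2) by (simp add: grid_Suc)
    qed
    note side_refine[of m]
    then have "z = (real (i * subdiv (Suc m) + i') * side (Suc m), real (j * subdiv (Suc m) + j') * side (Suc m))"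
      by (simp add: c(4) ij algebra_simps)
    with lt ij c show ?case by blast
  qed
  then show thesis using that by blast
qed

lemma corner_SucI:
  assumes "(real i * side m, real j * side m) \<in> carpet_corners a m"
    "i' < subdiv (Suc m)" "j' < subdiv (Suc m)" "\<not> (2 * i' + 1 = subdiv (Suc m) \<and> 2 * j' + 1 = subdiv (Suc m))"
  shows "(real (i * subdiv (Suc m) + i') * side (Suc m), real (j * subdiv (Suc m) + j') * side (Suc m))
    \<in> carpet_corners a (Suc m)"
proof -
  note side_refine[of m]
  then have "(real (i * subdiv (Suc m) + i') * side (Suc m), real (j * subdiv (Suc m) + j') * side (Suc m))
      = (real i * side m + real i' * side (Suc m), real j * side m + real j' * side (Suc m))"
    by (simp add: algebra_simps)
  with assms show ?thesis unfolding corner_Suc_iff by blast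
qed

lemma origin_corner: "(0, 0) \<in> carpet_corners a m"
proof (induction m)
  case (Suc m)
  then show ?case using corner_SucI[of 0 m 0 0 0] subdiv(3)[of "Suc m"] by simp
qed simp

lemma carpet_stage_iff:
  "(x, y) \<in> carpet_stage a m \<longleftrightarrow>
    (\<exists>X Y. (X, Y) \<in> carpet_corners a m \<and> X \<le> x \<and> x \<le> X + side m \<and> Y \<le> y \<and> y \<le> Y + side m)"
  unfolding carpet_stage_def carpet_squares_def by fastforce

lemma carpet_subset_square: "sierpinski_carpet a \<subseteq> {0..1} \<times> {0..1}"
proof -
  have "carpet_stage a 0 \<subseteq> {0..1} \<times> {0..1}"
    by (auto simp: carpet_stage_def carpet_squares_def carpet_side_def)
  then show ?thesis unfolding sierpinski_carpet_def by blast
qed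

lemma closed_carpet: "closed (sierpinski_carpet a)"
  unfolding sierpinski_carpet_def
proof (intro closed_INT ballI)
  fix m
  have "carpet_corners a m \<subseteq> (\<lambda>(i, j). (real i * side m, real j * side m)) ` ({..<grid m} \<times> {..<grid m})"
    by (rule subsetI, erule corner_grid) auto
  then have "finite (carpet_corners a m)" by (rule finite_subset) simp
  then show "closed (carpet_stage a m)"
    unfolding carpet_stage_def carpet_squares_def
    by (intro closed_Union) (auto intro!: closed_Times)
qed

text \<open>
  Where \<open>comb\<close> does not vanish, \<open>x\<close> lies in the open middle one of the \<open>subdiv (Suc m)\<close> parts of its cell.
  Openness matters: a closed part adjacent to the middle one shares only an end point with it.
\<close>

lemma central_strip:
  assumes "i' < subdiv (Suc m)"
    and x: "real (i * subdiv (Suc m) + i') * side (Suc m) \<le> x" "x \<le> (real (i * subdiv (Suc m) + i') + 1) * side (Suc m)"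
    and nz: "comb (grid m) (a (Suc m)) x \<noteq> 0"
  shows "2 * i' + 1 = subdiv (Suc m)"
proof -
  let ?K = "subdiv (Suc m)"
  obtain k where k: "\<bar>real (grid m) * x - real k - 1/2\<bar> < a (Suc m) / 2"
    using comb_nonzero_imp[OF nz a_pos] by blast
  define c where "c = ?K div 2"
  have c: "?K = 2 * c + 1" using subdiv(2)[of "Suc m"] by (simp add: c_def)
  have "\<bar>real (grid m) * x - real k - 1/2\<bar> * real ?K < a (Suc m) / 2 * real ?K"
    using k subdiv_pos[of m] by (intro mult_strict_right_mono) auto
  also have "\<dots> = 1 / 2" using subdiv_pos[of m] by (simp add: a_eq)
  finally have "\<bar>(real (grid m) * x - real k - 1/2) * real ?K\<bar> < 1 / 2"
    by (simp add: abs_mult)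
  moreover have "(real (grid m) * x - real k - 1/2) * real ?K = real (grid (Suc m)) * x - real (k * ?K + c) - 1/2"
    by (simp add: grid_Suc c algebra_simps)
  ultimately have 1: "real (k * ?K + c) < real (grid (Suc m)) * x" "real (grid (Suc m)) * x < real (k * ?K + c) + 1"
    by linarith+
  have 2: "real (i * ?K + i') \<le> real (grid (Suc m)) * x" "real (grid (Suc m)) * x \<le> real (i * ?K + i') + 1"
    using x grid_pos[of "Suc m"] by (simp_all add: side_eq field_simps)
  have "i * ?K + i' = k * ?K + c" using 1 2 by linarith
  moreover have "(i * ?K + i') mod ?K = i'" "(k * ?K + c) mod ?K = c"
    using assms(1) c by (simp_all only: mod_mult_self3) simp_all
  ultimately have "i' = c" by simp
  then show ?thesis using c by simp
qed

text \<open>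
  Otherwise the square of generation \<open>m + 1\<close> containing the point would have the middle index in both
  directions, and that square was discarded.
\<close>

lemma comb_product_zero:
  assumes "(x, y) \<in> sierpinski_carpet a"
  shows "comb (grid m) (a (Suc m)) x = 0 \<or> comb (grid m) (a (Suc m)) y = 0"
proof -
  have "(x, y) \<in> carpet_stage a (Suc m)" using assms by (auto simp: sierpinski_carpet_def)
  then obtain X Y where XY: "(X, Y) \<in> carpet_corners a (Suc m)"
    "X \<le> x" "x \<le> X + side (Suc m)" "Y \<le> y" "y \<le> Y + side (Suc m)"
    unfolding carpet_stage_iff by blast
  obtain X' Y' i' j' where c: "(X', Y') \<in> carpet_corners a m" "i' < subdiv (Suc m)" "j' < subdiv (Suc m)"
      "\<not> (2 * i' + 1 = subdiv (Suc m) \<and> 2 * j' + 1 = subdiv (Suc m))"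
      "X = X' + real i' * side (Suc m)" "Y = Y' + real j' * side (Suc m)"
    using XY(1) unfolding corner_Suc_iff by blast
  obtain i j where ij: "X' = real i * side m" "Y' = real j * side m"
    by (rule corner_grid[OF c(1)]) auto
  note side_refine[of m]
  then have "X = real (i * subdiv (Suc m) + i') * side (Suc m)" "Y = real (j * subdiv (Suc m) + j') * side (Suc m)"
    by (simp_all add: c ij algebra_simps)
  with central_strip[OF c(2), of i x] central_strip[OF c(3), of j y] XY c(4)
  show ?thesis by (fastforce simp: algebra_simps)
qed

text \<open>
  The square that is discarded from the grid square with indices \<open>(i, j)\<close>, taken closed.
\<close>

definition central_square :: "nat \<Rightarrow> nat \<times> nat \<Rightarrow> (real \<times> real) set" where
  "central_square m = (\<lambda>(i, j).
    (let lo = (\<lambda>k. real (k * subdiv (Suc m) + subdiv (Suc m) div 2) * side (Suc m))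
     in {lo i .. lo i + side (Suc m)} \<times> {lo j .. lo j + side (Suc m)}))"

lemma emeasure_square:
  fixes x y :: real
  assumes "h \<ge> 0"
  shows "emeasure lborel ({x .. x + h} \<times> {y .. y + h}) = ennreal (h\<^sup>2)"
    "emeasure lborel ({x ..< x + h} \<times> {y ..< y + h}) = ennreal (h\<^sup>2)"
  using assms unfolding lborel_prod[symmetric]
  by (simp_all add: lborel.emeasure_pair_measure_Times power2_eq_square ennreal_mult)

lemma emeasure_central_square: "emeasure lborel (central_square m p) = ennreal ((side (Suc m))\<^sup>2)"
  by (cases p) (simp add: central_square_def Let_def emeasure_square less_imp_le[OF side_pos])

lemma central_square_measurable: "central_square m p \<in> sets borel"
  by (cases p) (simp add: central_square_def Let_def closed_Times borel_closed)

definition cell :: "nat \<Rightarrow> real \<Rightarrow> nat" where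
  "cell m x = nat \<lfloor>x * real (grid m)\<rfloor>"

lemma cell_bounds:
  assumes "0 \<le> x"
  shows "real (cell m x) * side m \<le> x" "x < (real (cell m x) + 1) * side m"
proof -
  have "0 \<le> x * real (grid m)" using assms by simp
  then have "real (cell m x) \<le> x * real (grid m)" "x * real (grid m) < real (cell m x) + 1"
    unfolding cell_def by linarith+
  then show "real (cell m x) * side m \<le> x" "x < (real (cell m x) + 1) * side m"
    using grid_pos[of m] by (simp_all add: side_eq field_simps)
qed

lemma cell_Suc: "cell (Suc m) x = cell m x * subdiv (Suc m) + cell (Suc m) x mod subdiv (Suc m)"
proof -
  have "x * real (grid m) = x * real (grid (Suc m)) / real_of_int (int (subdiv (Suc m)))"
    using subdiv_pos[of m] by (simp add: grid_Suc)
  then have "\<lfloor>x * real (grid m)\<rfloor> = \<lfloor>x * real (grid (Suc m))\<rfloor> div int (subdiv (Suc m))"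
    by (simp only: floor_divide_real_eq_div)
  then have "cell (Suc m) x div subdiv (Suc m) = cell m x"
    unfolding cell_def by (simp add: nat_div_distrib')
  then show ?thesis using div_mult_mod_eq[of "cell (Suc m) x" "subdiv (Suc m)"] by simp
qed

text \<open>
  Of the grid squares that contain a point, the half-open one with indices \<open>(cell m x, cell m y)\<close> is
  followed through the generations.  It survives each subdivision unless the point falls into a central
  square.
\<close>

lemma corner_or_removed:
  assumes x: "0 \<le> x" "x < side M" and y: "0 \<le> y" "y < side M" and "M \<le> m"
    and avoid: "\<And>n. M \<le> n \<Longrightarrow> (x, y) \<notin> central_square n (cell n x, cell n y)"
  shows "(real (cell m x) * side m, real (cell m y) * side m) \<in> carpet_corners a m"
  using \<open>M \<le> m\<close>
proof (induction m rule: dec_induct)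
  case base
  have "cell M z = 0" if "0 \<le> z" "z < side M" for z
    using that grid_pos[of M] by (simp add: cell_def side_eq field_simps)
  then show ?case using x y origin_corner by simp
next
  case (step m)
  let ?K = "subdiv (Suc m)"
  have "\<not> (2 * (cell (Suc m) x mod ?K) + 1 = ?K \<and> 2 * (cell (Suc m) y mod ?K) + 1 = ?K)"
  proof
    assume "2 * (cell (Suc m) x mod ?K) + 1 = ?K \<and> 2 * (cell (Suc m) y mod ?K) + 1 = ?K"
    then have "cell (Suc m) x mod ?K = ?K div 2" "cell (Suc m) y mod ?K = ?K div 2" by linarith+
    then have "cell (Suc m) x = cell m x * ?K + ?K div 2" "cell (Suc m) y = cell m y * ?K + ?K div 2"
      using cell_Suc[of m x] cell_Suc[of m y] by simp_all
    then have "(x, y) \<in> central_square m (cell m x, cell m y)"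
      using cell_bounds[OF x(1), of "Suc m"] cell_bounds[OF y(1), of "Suc m"]
      by (simp add: central_square_def Let_def algebra_simps)
    with avoid[OF step.hyps(1)] show False by blast
  qed
  then show ?case
    using corner_SucI[OF step.IH, of "cell (Suc m) x mod ?K" "cell (Suc m) y mod ?K"] subdiv_pos[of m]
    by (simp add: cell_Suc[symmetric])
qed

lemma side_antimono: "M \<le> m \<Longrightarrow> side m \<le> side M"
proof (induction rule: dec_induct)
  case (step m)
  have "side (Suc m) \<le> side m"
    using subdiv_pos[of m] grid_pos[of m] by (simp add: side_eq grid_Suc divide_le_eq_1 field_simps)
  with step show ?case by simp
qed simp

text \<open>
  The central squares of all grid squares of generation \<open>m\<close> within \<open>[0, side M]\<^sup>2\<close>, including grid squares
  that have already been discarded: this simplifies the count and costs nothing in the estimate.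
\<close>

definition removed :: "nat \<Rightarrow> nat \<Rightarrow> (real \<times> real) set" where
  "removed M m = (\<Union>p \<in> {..<grid m div grid M} \<times> {..<grid m div grid M}. central_square m p)"

lemma grid_dvd: "M \<le> m \<Longrightarrow> grid M dvd grid m"
  by (induction rule: dec_induct) (auto simp: grid_Suc)

lemma square_covered:
  "{0..<side M} \<times> {0..<side M} \<subseteq> sierpinski_carpet a \<union> (\<Union>n. removed M (M + n))"
proof clarify
  fix x y assume x: "x \<in> {0..<side M}" and y: "y \<in> {0..<side M}"
    and out: "(x, y) \<notin> (\<Union>n. removed M (M + n))"
  have cell_less: "cell n z < grid n div grid M" if z: "0 \<le> z" "z < side M" and n: "M \<le> n" for z n
  proof -
    obtain q where q: "grid n = grid M * q" using grid_dvd[OF n] by blast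
    have "real (cell n z) * side n < side M" using cell_bounds(1)[OF z(1), of n] z(2) by linarith
    then have "cell n z < q"
      using grid_pos[of n] grid_pos[of M] unfolding side_eq q by (simp add: field_simps)
    then show ?thesis using grid_pos[of M] q by simp
  qed
  have avoid: "(x, y) \<notin> central_square n (cell n x, cell n y)" if "M \<le> n" for n
  proof
    assume "(x, y) \<in> central_square n (cell n x, cell n y)"
    then have "(x, y) \<in> removed M n"
      using cell_less[of x n] cell_less[of y n] x y that unfolding removed_def by fastforce
    then show False using out that by (metis UN_I UNIV_I le_add_diff_inverse)
  qed
  have "(x, y) \<in> carpet_stage a m" for m
  proof (cases "M \<le> m")
    case True
    then have "(real (cell m x) * side m, real (cell m y) * side m) \<in> carpet_corners a m"
      using x y avoid by (intro corner_or_removed[of x M y]) auto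
    moreover have "real (cell m x) * side m \<le> x" "x \<le> real (cell m x) * side m + side m"
      "real (cell m y) * side m \<le> y" "y \<le> real (cell m y) * side m + side m"
      using cell_bounds[of x m] cell_bounds[of y m] x y by (auto simp: algebra_simps)
    ultimately show ?thesis unfolding carpet_stage_iff by blast
  next
    case False
    then have "side M \<le> side m" by (intro side_antimono) simp
    then show ?thesis
      unfolding carpet_stage_iff using x y origin_corner[of m] by (intro exI[of _ 0]) auto
  qed
  then show "(x, y) \<in> sierpinski_carpet a" by (simp add: sierpinski_carpet_def)
qed

lemma removed_measurable: "removed M m \<in> sets lborel"
  unfolding removed_def by (intro sets.finite_UN) (auto simp: central_square_measurable)

text \<open>
  There are \<open>(side M / side m)\<^sup>2\<close> central squares of area \<open>(side m * a (Suc m))\<^sup>2\<close>.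
\<close>

lemma emeasure_removed:
  assumes "M \<le> m"
  shows "emeasure lborel (removed M m) \<le> ennreal ((side M)\<^sup>2 * (a (Suc m))\<^sup>2)"
proof -
  let ?q = "grid m div grid M"
  have "emeasure lborel (removed M m)
      \<le> (\<Sum>p \<in> {..<?q} \<times> {..<?q}. emeasure lborel (central_square m p))"
    unfolding removed_def
    by (rule emeasure_subadditive_finite) (auto simp: central_square_measurable)
  also have "\<dots> = ennreal ((real ?q * side (Suc m))\<^sup>2)"
    by (simp add: emeasure_central_square card_cartesian_product power2_eq_square
        ennreal_of_nat_eq_real_of_nat algebra_simps flip: ennreal_mult')
  also have "real ?q * side (Suc m) = side M * a (Suc m)"
  proof -
    obtain q where q: "grid m = grid M * q" using grid_dvd[OF assms] by blast
    then have "q > 0" using grid_pos[of m] by (cases q) auto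
    then show ?thesis using grid_pos[of M] subdiv_pos[of m] by (simp add: side_eq a_eq grid_Suc q)
  qed
  finally show ?thesis by (simp add: power_mult_distrib)
qed

text \<open>
  In a corner square of side \<open>side M\<close>, the area lost is at most \<open>(side M)\<^sup>2\<close> times the tail of the series
  from \<open>M\<close> on.  Passing to a tail is essential, as the whole sum of squares may exceed \<open>1\<close>.
\<close>

lemma carpet_not_null:
  assumes "summable (\<lambda>i. (a (Suc i))\<^sup>2)"
  shows "emeasure lborel (sierpinski_carpet a) \<noteq> 0"
proof
  assume null: "emeasure lborel (sierpinski_carpet a) = 0"
  obtain M where M: "\<And>n. n \<ge> M \<Longrightarrow> norm (\<Sum>i. (a (Suc (i + n)))\<^sup>2) < 1"
    using suminf_exist_split[OF zero_less_one assms] by blast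
  define t where "t = (\<Sum>n. (a (Suc (M + n)))\<^sup>2)"
  have t: "t < 1" using M[of M] by (simp add: t_def add.commute)
  have sm: "summable (\<lambda>n. (a (Suc (M + n)))\<^sup>2)"
    using summable_ignore_initial_segment[OF assms, of M] by (simp add: add.commute)
  have meas: "sierpinski_carpet a \<in> sets lborel" using closed_carpet by (simp add: borel_closed)
  have "ennreal ((side M)\<^sup>2) = emeasure lborel ({0..<side M} \<times> {0..<side M})"
    using emeasure_square(2)[of "side M" 0 0] side_pos[of M] by simp
  also have "\<dots> \<le> emeasure lborel (sierpinski_carpet a \<union> (\<Union>n. removed M (M + n)))"
    by (rule emeasure_mono[OF square_covered]) (use meas removed_measurable in auto)
  also have "\<dots> \<le> emeasure lborel (sierpinski_carpet a) + emeasure lborel (\<Union>n. removed M (M + n))"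
    by (rule emeasure_subadditive) (use meas removed_measurable in auto)
  also have "\<dots> = emeasure lborel (\<Union>n. removed M (M + n))" using null by simp
  also have "\<dots> \<le> (\<Sum>n. emeasure lborel (removed M (M + n)))"
    by (rule emeasure_subadditive_countably) (use removed_measurable in auto)
  also have "\<dots> \<le> (\<Sum>n. ennreal ((side M)\<^sup>2 * (a (Suc (M + n)))\<^sup>2))"
    by (intro suminf_le emeasure_removed) auto
  also have "\<dots> = ennreal (\<Sum>n. (side M)\<^sup>2 * (a (Suc (M + n)))\<^sup>2)"
    by (rule suminf_ennreal2) (auto intro: summable_mult sm)
  also have "(\<Sum>n. (side M)\<^sup>2 * (a (Suc (M + n)))\<^sup>2) = (side M)\<^sup>2 * t"
    unfolding t_def by (rule suminf_mult[OF sm])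
  finally have "(side M)\<^sup>2 \<le> (side M)\<^sup>2 * t"
    using suminf_nonneg[OF sm] by (simp add: ennreal_le_iff t_def)
  then show False using t side_pos[of M] by simp
qed

end

section \<open>Convergence in the space of square integrable functions\<close>

text \<open>
  The pair \<open>(0, B)\<close> lies in the closure of the graph, but a linear operator maps \<open>0\<close> to \<open>0\<close>.
\<close>

lemma not_closable_if_limit:
  fixes T :: "('p \<Rightarrow> 'v::euclidean_space) set \<Rightarrow> ('p \<Rightarrow> 'w::euclidean_space) set"
  assumes dom: "\<And>n. A n \<in> D"
    and lim: "limitin (L2_topology M) A (L2_zero M) sequentially"
    and limT: "limitin (L2_topology M) (\<lambda>n. T (A n)) B sequentially"
    and B: "B \<noteq> L2_zero M"
  shows "\<not> closable M D T"
proof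
  assume "closable M D T"
  then obtain D' and T' :: "('p \<Rightarrow> 'v) set \<Rightarrow> ('p \<Rightarrow> 'w) set"
    where lin: "linear_operator M D' T'"
      and cl: "prod_topology (L2_topology M) (L2_topology M) closure_of operator_graph D T = operator_graph D' T'"
    unfolding closable_def by blast
  let ?X = "prod_topology (L2_topology M) (L2_topology M) ::
    (('p \<Rightarrow> 'v) set \<times> ('p \<Rightarrow> 'w) set) topology"
  have "limitin ?X (\<lambda>n. (A n, T (A n))) (L2_zero M, B) sequentially"
    using lim limT by (simp add: limitin_pairwise o_def)
  moreover have "(A n, T (A n)) \<in> ?X closure_of operator_graph D T" if "A n \<in> topspace (L2_topology M)"
    "T (A n) \<in> topspace (L2_topology M)" for n
  proof -
    have "operator_graph D T \<inter> topspace ?X \<subseteq> ?X closure_of operator_graph D T"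
      using closure_of_subset_Int[of ?X "operator_graph D T"] by (simp add: Int_commute)
    then show ?thesis using that dom[of n] by (auto simp: operator_graph_def)
  qed
  moreover have "\<forall>\<^sub>F n in sequentially. A n \<in> topspace (L2_topology M)"
    "\<forall>\<^sub>F n in sequentially. T (A n) \<in> topspace (L2_topology M)"
    using lim limT openin_topspace unfolding limitin_def by blast+
  ultimately have "(L2_zero M, B) \<in> ?X closure_of operator_graph D T"
    by (intro limitin_closedin[where S = "?X closure_of operator_graph D T" and F = sequentially])
       (auto elim: eventually_elim2)
  then have "(L2_zero M, B) \<in> operator_graph D' T'" unfolding cl .
  then have "T' (L2_zero M) = B" "L2_zero M \<in> D'"
    unfolding operator_graph_def by auto
  moreover have "L2_scale M 0 Z = L2_zero M" for Z :: "('p \<Rightarrow> 'u::euclidean_space) set"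
    by (simp add: L2_scale_def L2_zero_def)
  ultimately have "B = L2_zero M"
    using lin unfolding linear_operator_def by (metis (no_types))
  with B show False by contradiction
qed

lemma continuous_in_L2_fun:
  fixes f :: "'a::euclidean_space \<Rightarrow> 'b::euclidean_space"
  assumes "compact S" "continuous_on S f"
  shows "f \<in> L2_fun (lebesgue_on S)"
proof -
  have S: "S \<in> lmeasurable" using assms(1) by (rule lmeasurable_compact)
  have meas [measurable]: "f \<in> borel_measurable (lebesgue_on S)"
    using assms S by (intro continuous_imp_measurable_on_sets_lebesgue) auto
  obtain c where c: "\<And>x. x \<in> S \<Longrightarrow> norm (f x) \<le> c"
    using compact_imp_bounded[OF compact_continuous_image[OF assms(2,1)]] unfolding bounded_iff by blast
  interpret finite_measure "lebesgue_on S" using S by (rule finite_measure_lebesgue_on)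
  have "integrable (lebesgue_on S) (\<lambda>x. (norm (f x))\<^sup>2)"
  proof (rule integrable_const_bound)
    show "AE x in lebesgue_on S. norm ((norm (f x))\<^sup>2) \<le> c\<^sup>2"
      by (rule AE_I2) (simp add: c power_mono)
  qed measurable
  then show ?thesis using meas by (simp add: L2_fun_def)
qed

lemma limitin_L2_if_uniform:
  fixes f :: "nat \<Rightarrow> 'p \<Rightarrow> 'v::euclidean_space"
  assumes fin: "finite_measure M" and f: "\<And>n. f n \<in> L2_fun M" and g: "g \<in> L2_fun M"
    and bound: "\<And>n x. x \<in> space M \<Longrightarrow> norm (f n x - g x) \<le> e n" and e: "e \<longlonglongrightarrow> 0"
  shows "limitin (L2_topology M) (\<lambda>n. L2_class M (f n)) (L2_class M g) sequentially"
proof -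
  interpret finite_measure M by fact
  interpret Metric_space "L2 M :: ('p \<Rightarrow> 'v) set set" "L2_dist M" by (rule Metric_space_L2)
  define c where "c = measure M (space M)"
  have dist: "L2_dist M (L2_class M (f n)) (L2_class M g) \<le> sqrt ((e n)\<^sup>2 * c)" for n
  proof -
    have "(LINT x|M. (norm (f n x - g x))\<^sup>2) \<le> (LINT x|M. (e n)\<^sup>2)"
    proof (rule integral_mono)
      show "integrable M (\<lambda>x. (norm (f n x - g x))\<^sup>2)"
        using L2_fun_diff[OF f g, of n] by (simp add: L2_fun_def)
    qed (simp_all add: bound power_mono)
    then show ?thesis by (simp add: L2_dist_class f g c_def mult.commute)
  qed
  have lim0: "(\<lambda>n. sqrt ((e n)\<^sup>2 * c)) \<longlonglongrightarrow> 0"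
    using tendsto_real_sqrt[OF tendsto_mult[OF tendsto_power[OF e, of 2] tendsto_const[of c]]] by simp
  have "(\<lambda>n. L2_dist M (L2_class M (f n)) (L2_class M g)) \<longlonglongrightarrow> 0"
  proof (rule tendsto_sandwich[OF _ _ tendsto_const lim0])
    show "\<forall>\<^sub>F n in sequentially. L2_dist M (L2_class M (f n)) (L2_class M g) \<le> sqrt ((e n)\<^sup>2 * c)"
      using dist by (rule always_eventually[OF allI])
  qed simp_all
  moreover have "L2_class M (f n) \<in> L2 M" "L2_class M g \<in> L2 M" for n
    using f g by (auto simp: L2_def)
  ultimately show ?thesis
    unfolding L2_topology_def by (simp add: limitin_metric_dist_null)
qed

section \<open>Small fields with curl close to one\<close>

context carpet_ratios begin

text \<open>
  The curl is \<open>1 - p(x) p(y)\<close>.  On the carpet one of \<open>x\<close>, \<open>y\<close> lies outside the support of the comb, where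
  \<open>p\<close> is at most the approximation error \<open>e\<close>; the other factor is at most \<open>3 / a (Suc n)\<close>.  The error
  \<open>e = side n * a (Suc n)\<close> is chosen so that this product is at most \<open>3 * side n\<close>.
\<close>

lemma small_field_with_curl_near_1:
  obtains u where "smooth u" "continuous_on UNIV (curl u)"
    "\<And>z. z \<in> sierpinski_carpet a \<Longrightarrow> norm (u z) \<le> 8 * (side n / a (Suc n))"
    "\<And>z. z \<in> sierpinski_carpet a \<Longrightarrow> \<bar>curl u z - 1\<bar> \<le> 3 * side n"
proof -
  let ?r = "a (Suc n)"
  let ?t = "comb (grid n) ?r"
  note r = a_pos[of n] a_le_1[of n]
  have side: "0 < side n" "side n \<le> 1" using side_pos[of n] grid_pos[of n] by (simp_all add: side_eq)
  define e where "e = side n * ?r"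
  have e: "0 < e" "e \<le> side n" "e \<le> 1"
    using side r mult_le_one[of "side n" ?r] by (auto simp: e_def mult_left_le)
  obtain p P where p: "real_polynomial_function p" and P: "real_polynomial_function P"
    and D: "\<And>x. (P has_real_derivative 1 - p x) (at x)"
    and pt: "\<And>x. x \<in> {0..1} \<Longrightarrow> \<bar>p x - ?t x\<bar> \<le> e"
    and PN: "\<And>x. x \<in> {0..1} \<Longrightarrow> \<bar>P x\<bar> \<le> 1 / real (grid n) + e"
    using polynomial_comb[OF r grid_pos e(1)] by blast
  define u where "u z = (- (p (fst z) * P (snd z)), P (fst z))" for z
  note u = product_field[OF p P D, folded u_def]
  have p_le: "\<bar>p x\<bar> \<le> 3 / ?r" if "x \<in> {0..1}" for x
  proof -
    have "e \<le> 1 / ?r" using e r by (simp add: le_divide_eq mult_le_one)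
    then have "\<bar>p x\<bar> \<le> 2 / ?r + 1 / ?r"
      using pt[OF that] comb_bounds[OF r, of "grid n" x] by linarith
    then show ?thesis by (simp add: add_divide_distrib[symmetric])
  qed
  have P_le: "\<bar>P x\<bar> \<le> 2 * side n" if "x \<in> {0..1}" for x
    using PN[OF that] e by (simp add: side_eq)
  show thesis
  proof (rule that[OF u(1)])
    have "continuous_on UNIV p"
      using p by (simp add: continuous_on_polymonial_function real_polynomial_function_eq)
    then have "continuous_on UNIV (\<lambda>z :: real \<times> real. p (fst z))" "continuous_on UNIV (\<lambda>z :: real \<times> real. p (snd z))"
      by (rule continuous_on_compose2; auto intro: continuous_intros)+
    then show "continuous_on UNIV (curl u)"
      unfolding u(2) split_beta by (intro continuous_intros)
  next
    fix z assume z: "z \<in> sierpinski_carpet a"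
    obtain x y where xy: "z = (x, y)" by (cases z)
    have I: "x \<in> {0..1}" "y \<in> {0..1}" using carpet_subset_square z xy by auto
    have le: "2 * side n \<le> 2 * (side n / ?r)" using r side by (simp add: le_divide_eq mult_left_le)
    have "norm (u z) \<le> \<bar>p x * P y\<bar> + \<bar>P x\<bar>"
      unfolding u_def xy using norm_Pair_le[of "- (p x * P y)" "P x"] by simp
    also have "\<dots> \<le> 3 / ?r * (2 * side n) + 2 * side n"
      unfolding abs_mult by (intro add_mono mult_mono p_le P_le I) (use r in auto)
    finally show "norm (u z) \<le> 8 * (side n / ?r)" using le by simp
    have small: "\<bar>p v * p w\<bar> \<le> 3 * side n" if "v \<in> {0..1}" "w \<in> {0..1}" "?t v = 0" for v w
    proof -
      have "\<bar>p v * p w\<bar> \<le> e * (3 / ?r)"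
        unfolding abs_mult using pt[OF that(1)] that(3) e by (intro mult_mono p_le that(2)) auto
      then show ?thesis using r by (simp add: e_def)
    qed
    have "\<bar>p x * p y\<bar> \<le> 3 * side n"
      using comb_product_zero[of x y n] z xy small[OF I] small[OF I(2,1)] by (auto simp: mult.commute)
    then show "\<bar>curl u z - 1\<bar> \<le> 3 * side n" by (simp add: u(2) xy)
  qed
qed

end

theorem corollary2p1:
  fixes a :: "nat \<Rightarrow> real"
    and Dom_curl :: "(real \<times> real \<Rightarrow> real \<times> real) set set"
    and curl_op :: "(real \<times> real \<Rightarrow> real \<times> real) set \<Rightarrow> (real \<times> real \<Rightarrow> real) set"
  assumes "summable (\<lambda>i. (a (Suc i))\<^sup>2)"
    and "\<And>i. i \<ge> 1 \<Longrightarrow> a i > 0"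
    and "\<And>i. i \<ge> 1 \<Longrightarrow> \<exists>k::int. odd k \<and> k > 1 \<and> 1 / a i = of_int k"
    and "(\<lambda>n. (\<Prod>k = 1..<n. a k) / a n) \<longlonglongrightarrow> 0"
    and "is_curl_operator (sierpinski_carpet a) Dom_curl curl_op"
    and "\<And>u. smooth u \<Longrightarrow> L2_class (lebesgue_on (sierpinski_carpet a)) u \<in> Dom_curl"
  shows "\<not> closable (lebesgue_on (sierpinski_carpet a)) Dom_curl curl_op"
proof -
  interpret carpet_ratios a by unfold_locales (rule assms(3))
  define S where "S = sierpinski_carpet a"
  define M where "M = lebesgue_on S"
  have "bounded S"
    using bounded_subset[OF bounded_Times[OF bounded_closed_interval bounded_closed_interval] carpet_subset_square]
    by (simp add: S_def)
  then have S: "compact S" using closed_carpet by (simp add: compact_eq_bounded_closed S_def)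
  have spM: "space M = S" by (simp add: M_def)
  have fin: "finite_measure M"
    unfolding M_def by (intro finite_measure_lebesgue_on lmeasurable_compact S)
  have "(\<lambda>n. (\<Prod>k = 1..<Suc n. a k) / a (Suc n)) \<longlonglongrightarrow> 0"
    using assms(4) by (rule LIMSEQ_Suc)
  then have ratio: "(\<lambda>n. side n / a (Suc n)) \<longlonglongrightarrow> 0"
    by (simp add: carpet_side_def atLeastLessThanSuc_atLeastAtMost)
  have "side n \<le> side n / a (Suc n)" for n
    using a_pos[of n] a_le_1[of n] side_pos[of n] by (simp add: le_divide_eq mult_left_le)
  then have side: "side \<longlonglongrightarrow> 0"
    by (intro tendsto_sandwich[OF _ _ tendsto_const ratio])
       (simp_all add: always_eventually less_imp_le[OF side_pos])
  have "\<exists>u. smooth u \<and> continuous_on UNIV (curl u) \<and> (\<forall>z\<in>S. norm (u z) \<le> 8 * (side n / a (Suc n)))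
      \<and> (\<forall>z\<in>S. \<bar>curl u z - 1\<bar> \<le> 3 * side n)" for n
    by (rule small_field_with_curl_near_1[of n]) (auto simp: S_def)
  then obtain u where "\<forall>n. smooth (u n) \<and> continuous_on UNIV (curl (u n)) \<and>
      (\<forall>z\<in>S. norm (u n z) \<le> 8 * (side n / a (Suc n))) \<and> (\<forall>z\<in>S. \<bar>curl (u n) z - 1\<bar> \<le> 3 * side n)"
    using choice[of "\<lambda>n u. smooth u \<and> continuous_on UNIV (curl u) \<and>
      (\<forall>z\<in>S. norm (u z) \<le> 8 * (side n / a (Suc n))) \<and> (\<forall>z\<in>S. \<bar>curl u z - 1\<bar> \<le> 3 * side n)"] by auto
  then have u: "\<And>n. smooth (u n)" "\<And>n. continuous_on UNIV (curl (u n))"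
    "\<And>n z. z \<in> S \<Longrightarrow> norm (u n z) \<le> 8 * (side n / a (Suc n))"
    "\<And>n z. z \<in> S \<Longrightarrow> \<bar>curl (u n) z - 1\<bar> \<le> 3 * side n"
    by auto
  have cont: "continuous_on UNIV (u n)" for n
    using u(1)[of n] unfolding smooth_def by (auto dest: spec[of _ 0])
  have "curl_op (L2_class M (u n)) = L2_class M (curl (u n))" for n
    using assms(5) u(1)[of n] assms(6)[OF u(1)] unfolding is_curl_operator_def M_def S_def by simp
  moreover have "limitin (L2_topology M) (\<lambda>n. L2_class M (curl (u n))) (L2_class M (\<lambda>_. 1)) sequentially"
  proof (rule limitin_L2_if_uniform[OF fin])
    show "(\<lambda>n. 3 * side n) \<longlonglongrightarrow> 0" using tendsto_mult_right_zero[OF side] .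
    show "curl (u n) \<in> L2_fun M" for n
      unfolding M_def by (intro continuous_in_L2_fun S continuous_on_subset[OF u(2)] subset_UNIV)
    show "(\<lambda>_. 1 :: real) \<in> L2_fun M"
      unfolding M_def by (intro continuous_in_L2_fun S continuous_on_const)
    show "norm (curl (u n) z - 1) \<le> 3 * side n" if "z \<in> space M" for n z
      using u(4) that by (simp add: spM)
  qed
  moreover have "limitin (L2_topology M) (\<lambda>n. L2_class M (u n)) (L2_zero M) sequentially"
    unfolding L2_zero_def
  proof (rule limitin_L2_if_uniform[OF fin])
    show "(\<lambda>n. 8 * (side n / a (Suc n))) \<longlonglongrightarrow> 0" using tendsto_mult_right_zero[OF ratio] .
    show "u n \<in> L2_fun M" for n
      unfolding M_def by (intro continuous_in_L2_fun S continuous_on_subset[OF cont] subset_UNIV)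
    show "(\<lambda>_. 0 :: real \<times> real) \<in> L2_fun M"
      unfolding M_def by (intro continuous_in_L2_fun S continuous_on_const)
    show "norm (u n z - 0) \<le> 8 * (side n / a (Suc n))" if "z \<in> space M" for n z
      using u(3) that by (simp only: spM diff_zero)
  qed
  moreover have "L2_class M (\<lambda>_. 1 :: real) \<noteq> L2_zero M"
  proof
    have "(\<lambda>_. 1 :: real) \<in> L2_fun M"
      unfolding M_def by (intro continuous_in_L2_fun S continuous_on_const)
    moreover assume "L2_class M (\<lambda>_. 1 :: real) = L2_zero M"
    ultimately have "AE x in M. False"
      unfolding L2_zero_def by (simp add: L2_class_eq_iff)
    then have "emeasure M (space M) = 0"
      by (simp add: AE_iff_measurable[OF sets.top])
    moreover have "emeasure M (space M) = emeasure lborel S"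
      using S unfolding M_def
      by (simp add: emeasure_restrict_space compact_imp_closed borel_closed)
    ultimately show False using carpet_not_null[OF assms(1)] by (simp add: S_def)
  qed
  ultimately show ?thesis
    using not_closable_if_limit[of "\<lambda>n. L2_class M (u n)" Dom_curl M curl_op "L2_class M (\<lambda>_. 1)"]
      assms(6)[OF u(1)] unfolding M_def S_def by simp
qed

end
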